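(* Let $n\ge 1$, let $\Omega$ be a finite subset of $\mathbb{Z}^n$, and let $\lambda_i$ be the $i$-th eigenvalue of the Dirichlet Laplacian on $\Omega$. If $\lambda_{k+1}\leq 1+\frac4n$ for some $1\leq k\leq \sharp \Omega-1$, then $$\lambda_{k+1}\leq \frac{\left(1+\frac4n\right)\sum_{i=1}^k\lambda_i-\sum_{i=1}^k\lambda_i^2}{\sum_{i=1}^k(1-\lambda_i)},$$ where the right-hand side is to be interpreted as $+\infty$ if $\sum_{i=1}^k(1-\lambda_i)=0$.
   Context: $\mathbb{Z}^n$ denotes the integer lattice graph: vertex set $\mathbb{Z}^n$, with $x\sim y$ (neighbors) iff $\sum_{i=1}^n|x_i-y_i|=1$; every vertex has degree $d_x=2n$. The discrete Laplacian is $\Delta f(x)=\frac{1}{d_x}\sum_{y\sim x}f(y)-f(x)$ for $f:\mathbb{Z}^n\to\mathbb{R}$. For a finite subset $\Omega\subset\mathbb{Z}^n$ and $f:\Omega\to\mathbb{R}$, the Dirichlet Laplacian is $\Delta_\Omega f(x)=\Delta\widetilde f(x)$ for $x\in\Omega$, where $\widetilde f$ is the extension of $f$ by $0$ to $\mathbb{Z}^n$. It is self-adjoint on functions on $\Omega$ with inner product $\langle f,g\rangle=\sum_{x\in\Omega}f(x)g(x)d_x$. The eigenvalues of the Dirichlet Laplacian on $\Omega$ are the eigenvalues of $-\Delta_\Omega$, listed in non-decreasing order with multiplicity: $0<\lambda_1\le\lambda_2\le\cdots\le\lambda_N\le 2$, where $N=\sharp\Omega$ is the number of vertices of $\Omega$.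 *)

theory Defs
  imports
    "HOL-Analysis.Analysis"
    "HOL-Library.Function_Algebras"
    "HOL-Library.Multiset"
begin

definition lattice_adj :: "int ^ 'n \<Rightarrow> int ^ 'n \<Rightarrow> bool" where
  "lattice_adj x y \<longleftrightarrow> (\<Sum>i\<in>UNIV. \<bar>x $ i - y $ i\<bar>) = 1"

definition lattice_degree :: "int ^ 'n \<Rightarrow> nat" where
  "lattice_degree x = card {y. lattice_adj x y}"

lemma lattice_degree_eq: "lattice_degree (x :: int^'n) = 2 * CARD('n)"
proof -
  have "{y. lattice_adj x y} = (\<lambda>(i,s). x + axis i s) ` (UNIV \<times> {1,-1})" (is "?L = ?R")
  proof
    show "?R \<subseteq> ?L"
    proof clarify
      fix i :: 'n and s :: int assume s: "s \<in> {1,-1}"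
      have "(\<Sum>j\<in>UNIV. \<bar>x $ j - (x + axis i s) $ j\<bar>) = (\<Sum>j\<in>UNIV. if j = i then 1 else 0)"
        by (rule sum.cong) (use s in \<open>auto simp: axis_def\<close>)
      then show "lattice_adj x (x + axis i s)" by (simp add: lattice_adj_def)
    qed
    show "?L \<subseteq> ?R"
    proof clarify
      fix y assume "lattice_adj x y"
      then have S: "(\<Sum>j\<in>UNIV. \<bar>x $ j - y $ j\<bar>) = 1" by (simp add: lattice_adj_def)
      then obtain i where i: "x $ i \<noteq> y $ i" by fastforce
      have "(\<Sum>j\<in>UNIV. \<bar>x $ j - y $ j\<bar>) = \<bar>x $ i - y $ i\<bar> + (\<Sum>j\<in>UNIV-{i}. \<bar>x $ j - y $ j\<bar>)"
        by (simp add: sum.remove[of UNIV i])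
      moreover have "(\<Sum>j\<in>UNIV-{i}. \<bar>x $ j - y $ j\<bar>) \<ge> 0" by (simp add: sum_nonneg)
      ultimately have a: "\<bar>x $ i - y $ i\<bar> = 1" and z: "(\<Sum>j\<in>UNIV-{i}. \<bar>x $ j - y $ j\<bar>) = 0" using i S by linarith+
      have "\<forall>j\<in>UNIV-{i}. \<bar>x $ j - y $ j\<bar> = 0" using z by (subst (asm) sum_nonneg_eq_0_iff) auto
      then have "y = x + axis i (y $ i - x $ i)" by (auto simp: vec_eq_iff axis_def)
      moreover have "y $ i - x $ i \<in> {1,-1}" using a by auto
      ultimately show "y \<in> ?R" by (metis (mono_tags, lifting) SigmaI UNIV_I case_prod_conv image_eqI)
    qed
  qed
  moreover have "inj_on (\<lambda>(i,s). x + axis i s) (UNIV \<times> {1,-1::int})"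
    by (auto simp: inj_on_def axis_eq_axis)
  ultimately show ?thesis by (simp add: lattice_degree_def card_image card_cartesian_product)
qed

definition lattice_laplacian :: "(int ^ 'n \<Rightarrow> real) \<Rightarrow> int ^ 'n \<Rightarrow> real" where
  "lattice_laplacian f x =
     (1 / real (lattice_degree x)) * (\<Sum>y | lattice_adj x y. f y) - f x"

definition zero_extension :: "(int ^ 'n) set \<Rightarrow> (int ^ 'n \<Rightarrow> real) \<Rightarrow> int ^ 'n \<Rightarrow> real" where
  "zero_extension \<Omega> f = (\<lambda>x. if x \<in> \<Omega> then f x else 0)"

text \<open>
  Real functions on \<open>\<Omega>\<close> are represented by the functions on the whole lattice that vanish
  outside \<open>\<Omega>\<close>; accordingly the Dirichlet Laplacian is given the value 0 outside \<open>\<Omega>\<close>.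
\<close>

definition functions_on :: "(int ^ 'n) set \<Rightarrow> (int ^ 'n \<Rightarrow> real) set" where
  "functions_on \<Omega> = {f. \<forall>x. x \<notin> \<Omega> \<longrightarrow> f x = 0}"

definition dirichlet_laplacian ::
    "(int ^ 'n) set \<Rightarrow> (int ^ 'n \<Rightarrow> real) \<Rightarrow> int ^ 'n \<Rightarrow> real" where
  "dirichlet_laplacian \<Omega> f x =
     (if x \<in> \<Omega> then lattice_laplacian (zero_extension \<Omega> f) x else 0)"

definition dirichlet_eigenspace :: "(int ^ 'n) set \<Rightarrow> real \<Rightarrow> (int ^ 'n \<Rightarrow> real) set" where
  "dirichlet_eigenspace \<Omega> \<mu> =
     {f \<in> functions_on \<Omega>. \<forall>x\<in>\<Omega>. - dirichlet_laplacian \<Omega> f x = \<mu> * f x}"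

definition dirichlet_spectrum :: "(int ^ 'n) set \<Rightarrow> real set" where
  "dirichlet_spectrum \<Omega> = {\<mu>. \<exists>f \<in> dirichlet_eigenspace \<Omega> \<mu>. f \<noteq> (\<lambda>x. 0)}"

text \<open>
  Functions do not form an instance of class \<open>real_vector\<close>, so the dimension is that of the
  vector space of real functions with pointwise operations, taken from the locale.
\<close>

global_interpretation fun_space: vector_space "\<lambda>(c::real) (f :: 'a \<Rightarrow> real) x. c * f x"
  by unfold_locales (auto simp: fun_eq_iff algebra_simps)

definition dirichlet_multiplicity :: "(int ^ 'n) set \<Rightarrow> real \<Rightarrow> nat" where
  "dirichlet_multiplicity \<Omega> \<mu> = fun_space.dim (dirichlet_eigenspace \<Omega> \<mu>)"

definition dirichlet_eigenvalues :: "(int ^ 'n) set \<Rightarrow> real list" where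
  "dirichlet_eigenvalues \<Omega> = sorted_list_of_multiset
     (\<Sum>\<mu>\<in>dirichlet_spectrum \<Omega>. replicate_mset (dirichlet_multiplicity \<Omega> \<mu>) \<mu>)"

text \<open>The index is 1-based, with \<open>1 \<le> i \<le> card \<Omega>\<close>.\<close>

definition dirichlet_eigenvalue :: "(int ^ 'n) set \<Rightarrow> nat \<Rightarrow> real" where
  "dirichlet_eigenvalue \<Omega> i = dirichlet_eigenvalues \<Omega> ! (i - 1)"

end

theory Submission
  imports Defs
begin

text \<open>
  Let \<open>u i\<close> be an orthonormal eigenbasis for the eigenvalues \<open>l i\<close>, let \<open>g\<close> be a coordinate
  function, and put \<open>a i j = \<langle>g u i, u j\<rangle>\<close>. The commutator of the operator with \<open>g\<close> has matrix
  entries \<open>(l i - l j) a i j\<close>, so Parseval expresses both its norm on \<open>u i\<close> and its pairing with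
  \<open>g u i\<close> by weighted sums of \<open>(a i j)\<^sup>2\<close>. Comparing the two sums as Harrell and Stubbe do, with no
  trial functions, and adding over all coordinates gives Yang's first inequality
  \<open>\<Sum> (\<Lambda> - l i)\<^sup>2 (1 - l i) \<le> (4 / n) \<Sum> (\<Lambda> - l i) l i\<close> with \<open>\<Lambda>\<close> the next eigenvalue.
  The summand is a product of two factors that decrease in \<open>l i\<close> as long as \<open>\<Lambda> \<le> 1 + 4 / n\<close>, so
  Chebyshev's sum inequality removes the factor \<open>\<Lambda> - l i\<close>. Dividing by \<open>\<Sum> (1 - l i)\<close> is allowed
  because the trace of the operator is the number of vertices, which makes the mean of the
  smallest eigenvalues at most 1.
\<close>

section \<open>Orthonormal eigenbases of symmetric kernels\<close>

text \<open>For small \<open>t\<close> a nonzero linear term dominates the quadratic one. This is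
  the first-variation argument applied below at a constrained minimiser.\<close>

lemma linear_coefficient_eq_0:
  fixes a c :: real
  assumes "\<And>t. 0 \<le> 2 * t * a + t\<^sup>2 * c"
  shows "a = 0"
proof (rule ccontr)
  assume "a \<noteq> 0"
  define d where "d = \<bar>c\<bar> + 1"
  have d: "d > 0" "c < d" by (auto simp: d_def)
  have "0 \<le> 2 * (- a / d) * a + (- a / d)\<^sup>2 * c" by (rule assms)
  also have "\<dots> = a\<^sup>2 * (c - 2 * d) / d\<^sup>2"
    using d by (simp add: field_simps power2_eq_square)
  also have "\<dots> < 0"
    using d \<open>a \<noteq> 0\<close> by (intro divide_neg_pos mult_pos_neg) auto
  finally show False by simp
qed

lemma sum_fun_apply: "sum F A x = (\<Sum>a\<in>A. F a x)" for F :: "'b \<Rightarrow> 'a \<Rightarrow> 'c :: comm_monoid_add"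
  by (induction A rule: infinite_finite_induct) auto

text \<open>Bridges two ways of listing eigenvalues: distinct values repeated by multiplicity, and
  one value per member of an eigenbasis.\<close>

lemma sum_replicate_mset_card_vimage:
  assumes "finite I"
  shows "(\<Sum>\<mu>\<in>l ` I. replicate_mset (card {i \<in> I. l i = \<mu>}) \<mu>) = image_mset l (mset_set I)"
proof (rule multiset_eqI)
  fix x
  have "count (image_mset l (mset_set I)) x = card {i \<in> I. l i = x}"
    using assms by (simp add: count_image_mset vimage_def Int_def conj_commute)
  moreover have "card {i \<in> I. l i = x} = 0" if "x \<notin> l ` I"
    using that by (auto simp: card_eq_0_iff)
  ultimately show "count (\<Sum>\<mu>\<in>l ` I. replicate_mset (card {i \<in> I. l i = \<mu>}) \<mu>) x
      = count (image_mset l (mset_set I)) x"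
    using assms by (auto simp: count_sum if_distrib)
qed

section \<open>The quadratic form and the operator of a symmetric kernel\<close>

locale symmetric_kernel =
  fixes S :: "'a set" and K :: "'a \<Rightarrow> 'a \<Rightarrow> real"
  assumes finite_S: "finite S"
    and sym: "\<And>x y. x \<in> S \<Longrightarrow> y \<in> S \<Longrightarrow> K x y = K y x"
begin

text \<open>The degree weight is the constant 2n on the lattice, so dropping it only rescales the
  inner product and changes neither orthogonality nor self-adjointness.\<close>

definition dot :: "('a \<Rightarrow> real) \<Rightarrow> ('a \<Rightarrow> real) \<Rightarrow> real" where
  "dot f g = (\<Sum>x\<in>S. f x * g x)"

definition oper :: "('a \<Rightarrow> real) \<Rightarrow> 'a \<Rightarrow> real" where
  "oper f x = (if x \<in> S then \<Sum>y\<in>S. K x y * f y else 0)"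

definition supp_S :: "('a \<Rightarrow> real) \<Rightarrow> bool" where
  "supp_S f \<longleftrightarrow> (\<forall>x. x \<notin> S \<longrightarrow> f x = 0)"

text \<open>The length \<open>m\<close> may be smaller than \<open>card S\<close>, so that systems
  can be grown one vector at a time. Off \<open>S\<close> both sides of the eigenvalue equation
  vanish, which allows an equation between functions.\<close>

definition eigensystem :: "nat \<Rightarrow> (nat \<Rightarrow> 'a \<Rightarrow> real) \<Rightarrow> (nat \<Rightarrow> real) \<Rightarrow> bool" where
  "eigensystem m u l \<longleftrightarrow> (\<forall>i<m. supp_S (u i) \<and> oper (u i) = (\<lambda>x. l i * u i x) \<and>
     (\<forall>j<m. dot (u i) (u j) = of_bool (i = j)))"

lemma dot_commute: "dot f g = dot g f"
  by (simp add: dot_def mult.commute)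

lemma dot_add_left: "dot (\<lambda>x. f x + g x) h = dot f h + dot g h"
  by (simp add: dot_def sum.distrib ring_distribs)

lemma dot_add_right: "dot h (\<lambda>x. f x + g x) = dot h f + dot h g"
  by (simp add: dot_def sum.distrib ring_distribs)

lemma dot_diff_left: "dot (\<lambda>x. f x - g x) h = dot f h - dot g h"
  by (simp add: dot_def sum_subtractf ring_distribs)

lemma dot_scale_left: "dot (\<lambda>x. c * f x) h = c * dot f h"
  by (simp add: dot_def sum_distrib_left mult_ac)

lemma dot_scale_right: "dot h (\<lambda>x. c * f x) = c * dot h f"
  by (simp add: dot_def sum_distrib_left mult_ac)

lemma dot_sum_left: "dot (\<lambda>x. \<Sum>i\<in>I. F i x) h = (\<Sum>i\<in>I. dot (F i) h)"
  unfolding dot_def by (subst sum.swap) (simp add: sum_distrib_right)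

lemma dot_self_nonneg: "dot f f \<ge> 0"
  by (simp add: dot_def sum_nonneg)

lemma dot_self_eq_0: "dot f f = 0 \<Longrightarrow> x \<in> S \<Longrightarrow> f x = 0"
  using finite_S by (simp add: dot_def sum_nonneg_eq_0_iff)

lemma dot_self_eq_0_imp_zero: "dot f f = 0 \<Longrightarrow> supp_S f \<Longrightarrow> f = (\<lambda>x. 0)"
  using dot_self_eq_0 by (auto simp: supp_S_def fun_eq_iff)

lemma oper_add: "oper (\<lambda>x. f x + g x) = (\<lambda>x. oper f x + oper g x)"
  by (auto simp: oper_def fun_eq_iff sum.distrib ring_distribs)

lemma oper_scale: "oper (\<lambda>x. c * f x) = (\<lambda>x. c * oper f x)"
  by (auto simp: oper_def fun_eq_iff sum_distrib_left mult_ac)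

lemma supp_oper: "supp_S (oper f)"
  by (simp add: supp_S_def oper_def)

lemma dot_oper: "dot (oper f) g = (\<Sum>x\<in>S. (\<Sum>y\<in>S. K x y * f y) * g x)"
  by (simp add: dot_def oper_def)

lemma oper_symmetric: "dot (oper f) g = dot f (oper g)"
proof -
  have "dot (oper f) g = (\<Sum>x\<in>S. \<Sum>y\<in>S. K x y * f y * g x)"
    by (simp add: dot_oper sum_distrib_right)
  also have "\<dots> = (\<Sum>y\<in>S. \<Sum>x\<in>S. K x y * f y * g x)"
    by (rule sum.swap)
  also have "\<dots> = dot f (oper g)"
    by (auto simp: dot_def oper_def sum_distrib_left sym mult_ac intro!: sum.cong)
  finally show ?thesis .
qed

lemma eigensystemD:
  assumes "eigensystem m u l" "i < m"
  shows "supp_S (u i)" "oper (u i) = (\<lambda>x. l i * u i x)"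
    "j < m \<Longrightarrow> dot (u i) (u j) = of_bool (i = j)"
  using assms by (auto simp: eigensystem_def)

lemma dot_indicator: "x \<in> S \<Longrightarrow> dot (\<lambda>y. of_bool (y = x)) f = f x"
  using finite_S by (simp add: dot_def)

lemma dot_residual:
  assumes "eigensystem m u l" "j < m"
  shows "dot (\<lambda>y. f y - (\<Sum>i<m. dot f (u i) * u i y)) (u j) = 0"
proof -
  have "dot (\<lambda>y. f y - (\<Sum>i<m. dot f (u i) * u i y)) (u j) = dot f (u j) - (\<Sum>i<m. dot f (u i) * dot (u i) (u j))"
    by (simp add: dot_diff_left dot_sum_left dot_scale_left)
  also have "(\<Sum>i<m. dot f (u i) * dot (u i) (u j)) = (\<Sum>i<m. if i = j then dot f (u i) else 0)"
    using assms by (intro sum.cong) (auto simp: eigensystemD(3))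
  finally show ?thesis using assms by simp
qed

text \<open>Bessel's identity: the residual is orthogonal to the projection that was subtracted, so
  Pythagoras applies.\<close>

lemma dot_residual_self:
  assumes "eigensystem m u l"
  defines "r \<equiv> \<lambda>f y. f y - (\<Sum>i<m. dot f (u i) * u i y)"
  shows "dot (r f) (r f) = dot f f - (\<Sum>i<m. (dot f (u i))\<^sup>2)"
proof -
  have "dot (\<lambda>y. \<Sum>i<m. dot f (u i) * u i y) (r f) = 0"
    using dot_residual[OF assms(1)]
    by (simp add: dot_sum_left dot_scale_left r_def dot_commute[of _ "\<lambda>y. f y - (\<Sum>i<m. dot f (u i) * u i y)"])
  then have "dot (r f) (r f) = dot f (r f)"
    by (subst (1) r_def) (simp add: dot_diff_left)
  also have "\<dots> = dot (r f) f"
    by (rule dot_commute)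
  also have "\<dots> = dot f f - (\<Sum>i<m. (dot f (u i))\<^sup>2)"
  proof -
    have "dot (u i) f = dot f (u i)" for i by (rule dot_commute)
    then show ?thesis
      by (simp add: r_def dot_diff_left dot_sum_left dot_scale_left power2_eq_square)
  qed
  finally show ?thesis .
qed

text \<open>
  Applied with \<open>m < card S\<close> this yields a new direction orthogonal to the system, and with
  \<open>m = card S\<close> it yields completeness; no dimension theory is needed.
\<close>

lemma sum_residual_indicator:
  assumes "eigensystem m u l"
  defines "r \<equiv> \<lambda>f y. f y - (\<Sum>i<m. dot f (u i) * u i y)"
  shows "(\<Sum>x\<in>S. dot (r (\<lambda>y. of_bool (y = x))) (r (\<lambda>y. of_bool (y = x)))) = real (card S) - real m"
proof -
  have "(\<Sum>x\<in>S. dot (r (\<lambda>y. of_bool (y = x))) (r (\<lambda>y. of_bool (y = x))))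
      = (\<Sum>x\<in>S. 1 - (\<Sum>i<m. (u i x)\<^sup>2))"
    unfolding r_def
    by (intro sum.cong refl, subst dot_residual_self[OF assms(1)]) (simp add: dot_indicator)
  also have "\<dots> = real (card S) - (\<Sum>i<m. \<Sum>x\<in>S. (u i x)\<^sup>2)"
    by (simp add: sum_subtractf sum.swap[of _ S])
  also have "(\<Sum>i<m. \<Sum>x\<in>S. (u i x)\<^sup>2) = (\<Sum>i<m. dot (u i) (u i))"
    by (simp add: dot_def power2_eq_square)
  also have "\<dots> = real m"
    using assms by (simp add: eigensystemD(3))
  finally show ?thesis .
qed

section \<open>Existence and completeness of orthonormal eigensystems\<close>

lemma exists_orthogonal:
  assumes "eigensystem m u l" "m < card S"
  obtains f where "supp_S f" "dot f f \<noteq> 0" "\<And>j. j < m \<Longrightarrow> dot f (u j) = 0"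
proof -
  let ?r = "\<lambda>f y. f y - (\<Sum>i<m. dot f (u i) * u i y)"
  have "(\<Sum>x\<in>S. dot (?r (\<lambda>y. of_bool (y = x))) (?r (\<lambda>y. of_bool (y = x)))) \<noteq> 0"
    using sum_residual_indicator[OF assms(1)] assms(2) by simp
  then obtain x where x: "x \<in> S" "dot (?r (\<lambda>y. of_bool (y = x))) (?r (\<lambda>y. of_bool (y = x))) \<noteq> 0"
    by (meson sum.neutral)
  show thesis
  proof (rule that[OF _ x(2)])
    show "supp_S (?r (\<lambda>y. of_bool (y = x)))"
      using x(1) eigensystemD(1)[OF assms(1)] by (auto simp: supp_S_def)
  qed (rule dot_residual[OF assms(1)])
qed

text \<open>The Rayleigh quotient attains its minimum on the unit sphere of the orthogonal
  complement, which is compact. The final inequality is kept homogeneous so that it also covers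
  \<open>f = 0\<close>.\<close>

lemma exists_minimizer:
  assumes "eigensystem m u l" "m < card S"
  obtains v where "supp_S v" "dot v v = 1" "\<And>j. j < m \<Longrightarrow> dot v (u j) = 0"
    "\<And>f. supp_S f \<Longrightarrow> (\<And>j. j < m \<Longrightarrow> dot f (u j) = 0) \<Longrightarrow>
      dot (oper v) v * dot f f \<le> dot (oper f) f"
proof -
  \<comment> \<open>The type \<open>'a\<close> may be infinite, so compactness comes from Tychonoff:
    every factor is an interval or a point. Unit vectors supported on \<open>S\<close> lie in this
    box because no squared entry exceeds the squared norm.\<close>
  define B where "B = PiE UNIV (\<lambda>x. if x \<in> S then {-1..1::real} else {0})"
  define C where "C = B \<inter> ({f. dot f f = 1} \<inter> (\<Inter>j<m. {f. dot f (u j) = 0}))"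
  have "compactin (product_topology (\<lambda>_::'a. euclidean :: real topology) UNIV) B"
    unfolding B_def by (subst compactin_PiE) auto
  then have "compact B" by (simp add: euclidean_product_topology)
  have cont: "continuous_on A (\<lambda>f. dot f g)" "continuous_on A (\<lambda>f. dot f f)"
      "continuous_on A (\<lambda>f. dot (oper f) f)" for A g
  proof -
    have c: "continuous_on A (\<lambda>f::'a \<Rightarrow> real. f x)" for x
      by (rule continuous_on_subset[OF continuous_on_product_coordinates subset_UNIV])
    show "continuous_on A (\<lambda>f. dot f g)" "continuous_on A (\<lambda>f. dot f f)"
      "continuous_on A (\<lambda>f. dot (oper f) f)"
      unfolding dot_oper unfolding dot_def
      by (intro continuous_on_sum continuous_on_mult continuous_on_const c)+
  qed
  have "closed {f. dot f f = 1}"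
    using closed_Collect_eq[OF cont(2)[of UNIV] continuous_on_const[of UNIV 1]] .
  moreover have "closed (\<Inter>j<m. {f. dot f (u j) = 0})"
    using closed_Collect_eq[OF cont(1)[of UNIV] continuous_on_const[of UNIV 0]]
    by (intro closed_INT ballI)
  ultimately have "closed ({f. dot f f = 1} \<inter> (\<Inter>j<m. {f. dot f (u j) = 0}))"
    by (rule closed_Int)
  then have "compact C"
    unfolding C_def by (rule compact_Int_closed[OF \<open>compact B\<close>])
  have C: "f \<in> C" if "supp_S f" "dot f f = 1" "\<And>j. j < m \<Longrightarrow> dot f (u j) = 0" for f
  proof -
    have "\<bar>f x\<bar> \<le> 1" if "x \<in> S" for x
    proof -
      have "f x * f x \<le> dot f f"
        unfolding dot_def using finite_S that by (intro member_le_sum) auto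
      then show ?thesis
        using \<open>dot f f = 1\<close> by (simp add: abs_le_square_iff[of "f x" 1, simplified] power2_eq_square)
    qed
    then show ?thesis
      using that by (auto simp: C_def B_def supp_S_def abs_le_iff minus_le_iff)
  qed
  have normalize: "(\<lambda>x. (1 / sqrt (dot f f)) * f x) \<in> C"
    if "supp_S f" "dot f f \<noteq> 0" "\<And>j. j < m \<Longrightarrow> dot f (u j) = 0" for f
  proof (rule C)
    show "dot (\<lambda>x. (1 / sqrt (dot f f)) * f x) (\<lambda>x. (1 / sqrt (dot f f)) * f x) = 1"
      using that(2) dot_self_nonneg[of f] unfolding dot_scale_left dot_scale_right
      by (simp add: field_simps)
    show "supp_S (\<lambda>x. (1 / sqrt (dot f f)) * f x)" using that(1) by (simp add: supp_S_def)
    show "dot (\<lambda>x. (1 / sqrt (dot f f)) * f x) (u j) = 0" if "j < m" for j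
      using \<open>\<And>j. j < m \<Longrightarrow> dot f (u j) = 0\<close>[OF that] unfolding dot_scale_left by simp
  qed
  have "C \<noteq> {}"
    using normalize exists_orthogonal[OF assms] by (metis empty_iff)
  then obtain v where v: "v \<in> C" "\<And>f. f \<in> C \<Longrightarrow> dot (oper v) v \<le> dot (oper f) f"
    using continuous_attains_inf[OF \<open>compact C\<close> _ cont(3)] by auto
  show thesis
  proof (rule that[of v])
    show "supp_S v"
      using v(1) by (auto simp: C_def B_def supp_S_def PiE_iff split: if_splits)
    show "dot v v = 1" "\<And>j. j < m \<Longrightarrow> dot v (u j) = 0"
      using v(1) by (auto simp: C_def)
    fix f assume f: "supp_S f" "\<And>j. j < m \<Longrightarrow> dot f (u j) = 0"
    show "dot (oper v) v * dot f f \<le> dot (oper f) f"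
    proof (cases "dot f f = 0")
      case True
      then have "f = (\<lambda>x. 0)" using f(1) by (rule dot_self_eq_0_imp_zero)
      then show ?thesis by (simp add: dot_def)
    next
      case False
      have "dot (oper v) v \<le> (1 / sqrt (dot f f))\<^sup>2 * dot (oper f) f"
        using v(2)[OF normalize[OF f(1) False f(2)]]
        unfolding oper_scale dot_scale_left dot_scale_right by (simp add: power2_eq_square)
      then show ?thesis
        using False dot_self_nonneg[of f] by (simp add: power_divide field_simps)
    qed
  qed
qed

text \<open>The residual \<open>r\<close> of the minimiser \<open>v\<close> is again orthogonal to
  all \<open>u j\<close>, since the operator is symmetric, so \<open>v\<close> may be varied in
  direction \<open>r\<close>. The first variation there is \<open>dot r r\<close>, which must
  vanish.\<close>

lemma eigensystem_extend:
  assumes E: "eigensystem m u l" and "m < card S"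
  shows "\<exists>u l. eigensystem (Suc m) u l"
proof -
  obtain v where v: "supp_S v" "dot v v = 1" "\<And>j. j < m \<Longrightarrow> dot v (u j) = 0"
    and min: "\<And>f. supp_S f \<Longrightarrow> (\<And>j. j < m \<Longrightarrow> dot f (u j) = 0) \<Longrightarrow>
      dot (oper v) v * dot f f \<le> dot (oper f) f"
    by (rule exists_minimizer[OF assms]) blast
  define \<mu> where "\<mu> = dot (oper v) v"
  define r where "r = (\<lambda>x. oper v x - \<mu> * v x)"
  have supp_r: "supp_S r"
    using v(1) supp_oper[of v] by (simp add: r_def supp_S_def)
  have r_orth: "dot r (u j) = 0" if "j < m" for j
  proof -
    have "dot (oper v) (u j) = dot v (\<lambda>x. l j * u j x)"
      by (simp add: oper_symmetric eigensystemD(2)[OF E that])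
    then show ?thesis
      using v(3)[OF that] by (simp add: r_def dot_diff_left dot_scale_left dot_scale_right)
  qed
  have rr: "dot (oper v) r - \<mu> * dot v r = dot r r"
    unfolding r_def by (simp add: dot_diff_left dot_scale_left)
  \<comment> \<open>This expands the quadratic form of \<open>oper\<close> minus
    \<open>\<mu>\<close> at \<open>v + t * r\<close>. Its constant term is 0 by the choice of
    \<open>\<mu>\<close> and \<open>dot v v = 1\<close>; its linear term is identified by
    \<open>rr\<close>.\<close>
  have "0 \<le> 2 * t * dot r r + t\<^sup>2 * (dot (oper r) r - \<mu> * dot r r)" for t
  proof -
    have "\<mu> * dot (\<lambda>x. v x + t * r x) (\<lambda>x. v x + t * r x)
        \<le> dot (oper (\<lambda>x. v x + t * r x)) (\<lambda>x. v x + t * r x)"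
      unfolding \<mu>_def
    proof (rule min)
      show "supp_S (\<lambda>x. v x + t * r x)" using v(1) supp_r by (simp add: supp_S_def)
      show "dot (\<lambda>x. v x + t * r x) (u j) = 0" if "j < m" for j
        using that by (simp add: dot_add_left dot_scale_left v(3) r_orth)
    qed
    moreover have "dot r v = dot v r" "dot (oper r) v = dot (oper v) r"
      using dot_commute oper_symmetric by metis+
    moreover have "2 * t * dot r r = 2 * t * dot (oper v) r - \<mu> * (2 * t * dot v r)"
      unfolding rr[symmetric] by (simp add: algebra_simps)
    ultimately show ?thesis
      using v(2)
      by (simp add: oper_add oper_scale dot_add_left dot_add_right dot_scale_left dot_scale_right
          \<mu>_def[symmetric] algebra_simps power2_eq_square)
  qed
  then have "dot r r = 0" by (rule linear_coefficient_eq_0)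
  then have "r = (\<lambda>x. 0)" using supp_r by (rule dot_self_eq_0_imp_zero)
  then have "oper v = (\<lambda>x. \<mu> * v x)" by (auto simp: r_def fun_eq_iff)
  then have "eigensystem (Suc m) (u(m := v)) (l(m := \<mu>))"
    using E v v(3)[unfolded dot_commute[of v]]
    by (auto simp: eigensystem_def less_Suc_eq)
  then show ?thesis by blast
qed

lemma eigensystem_exists: "m \<le> card S \<Longrightarrow> \<exists>u l. eigensystem m u l"
proof (induction m)
  case 0
  show ?case by (simp add: eigensystem_def)
next
  case (Suc m)
  then show ?case using eigensystem_extend by (metis Suc_leD Suc_le_lessD)
qed

text \<open>The extension step does not record that successive minima increase, so the finished
  system is permuted into order.\<close>

lemma eigensystem_exists_sorted:
  obtains u l where "eigensystem (card S) u l" "\<And>i j. i \<le> j \<Longrightarrow> j < card S \<Longrightarrow> l i \<le> l j"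
proof -
  let ?N = "card S"
  obtain u l where E: "eigensystem ?N u l" using eigensystem_exists by blast
  define p where "p = sort_key l [0..<?N]"
  have len: "length p = ?N" and "distinct p" and set: "set p = {..<?N}" and srt: "sorted (map l p)"
    by (auto simp: p_def)
  have lt: "p ! i < ?N" if "i < ?N" for i
    using that set len nth_mem by (metis lessThan_iff)
  have "eigensystem ?N (\<lambda>i. u (p ! i)) (\<lambda>i. l (p ! i))"
    unfolding eigensystem_def
    using eigensystemD[OF E lt] lt \<open>distinct p\<close> len by (auto simp: nth_eq_iff_index_eq)
  moreover have "l (p ! i) \<le> l (p ! j)" if "i \<le> j" "j < ?N" for i j
    using sorted_nth_mono[OF srt, of i j] that len by simp
  ultimately show thesis by (rule that)
qed

text \<open>With \<open>card S\<close> eigenfunctions the squared residuals of all indicators add up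
  to 0, so every indicator equals its own expansion. An arbitrary \<open>f\<close> is, on
  \<open>S\<close>, a combination of indicators.\<close>

lemma eigensystem_expand:
  assumes "eigensystem (card S) u l" "x \<in> S"
  shows "f x = (\<Sum>i<card S. dot f (u i) * u i x)"
proof -
  let ?r = "\<lambda>f y. f y - (\<Sum>i<card S. dot f (u i) * u i y)"
  let ?d = "\<lambda>x y. of_bool (y = x) :: real"
  have "(\<Sum>x\<in>S. dot (?r (?d x)) (?r (?d x))) = 0"
    using sum_residual_indicator[OF assms(1)] by simp
  then have "dot (?r (?d z)) (?r (?d z)) = 0" if "z \<in> S" for z
    using that finite_S by (simp add: sum_nonneg_eq_0_iff dot_self_nonneg)
  then have "?r (?d z) x = 0" if "z \<in> S" for z
    using that dot_self_eq_0[of "?r (?d z)"] assms(2) by blast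
  then have d: "?d z x = (\<Sum>i<card S. u i z * u i x)" if "z \<in> S" for z
    using that by (simp add: dot_indicator)
  have "f x = (\<Sum>z\<in>S. f z * ?d z x)"
    using assms(2) finite_S by simp
  also have "\<dots> = (\<Sum>z\<in>S. \<Sum>i<card S. f z * u i z * u i x)"
    by (intro sum.cong) (auto simp: d sum_distrib_left mult_ac)
  also have "\<dots> = (\<Sum>i<card S. dot f (u i) * u i x)"
    by (subst sum.swap) (simp add: dot_def sum_distrib_right)
  finally show ?thesis .
qed

lemma parseval:
  assumes "eigensystem (card S) u l"
  shows "dot f g = (\<Sum>i<card S. dot f (u i) * dot g (u i))"
proof -
  have "dot f g = (\<Sum>x\<in>S. (\<Sum>i<card S. dot f (u i) * u i x) * g x)"
    unfolding dot_def[of f g]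
    by (rule sum.cong) (auto simp flip: eigensystem_expand[OF assms])
  also have "\<dots> = dot (\<lambda>x. \<Sum>i<card S. dot f (u i) * u i x) g"
    by (simp add: dot_def)
  also have "\<dots> = (\<Sum>i<card S. dot f (u i) * dot g (u i))"
    by (simp add: dot_sum_left dot_scale_left dot_commute[of _ g])
  finally show ?thesis .
qed

text \<open>A diagonal entry is the value at \<open>x\<close> of the operator applied to the
  indicator of \<open>x\<close>. Expanding it and summing over \<open>x\<close> leaves each
  eigenvalue times the squared norm of its eigenfunction.\<close>

lemma trace_eq_sum_eigenvalues:
  assumes "eigensystem (card S) u l"
  shows "(\<Sum>i<card S. l i) = (\<Sum>x\<in>S. K x x)"
proof -
  have "K x x = (\<Sum>i<card S. l i * (u i x)\<^sup>2)" if "x \<in> S" for x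
  proof -
    let ?d = "\<lambda>y. of_bool (y = x) :: real"
    have "K x x = oper ?d x" using that finite_S by (simp add: oper_def)
    also have "\<dots> = (\<Sum>i<card S. dot (oper ?d) (u i) * u i x)"
      by (rule eigensystem_expand[OF assms that])
    also have "\<dots> = (\<Sum>i<card S. l i * (u i x)\<^sup>2)"
      using that by (intro sum.cong) (auto simp: oper_symmetric eigensystemD(2)[OF assms]
          dot_indicator power2_eq_square)
    finally show ?thesis .
  qed
  then have "(\<Sum>x\<in>S. K x x) = (\<Sum>x\<in>S. \<Sum>i<card S. l i * (u i x)\<^sup>2)" by simp
  also have "\<dots> = (\<Sum>i<card S. l i * dot (u i) (u i))"
    by (subst sum.swap) (simp add: dot_def sum_distrib_left power2_eq_square)
  also have "\<dots> = (\<Sum>i<card S. l i)"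
    by (intro sum.cong) (auto simp: eigensystemD(3)[OF assms])
  finally show ?thesis by simp
qed

section \<open>Multiplicities read off from an eigensystem\<close>

definition eigenspace :: "real \<Rightarrow> ('a \<Rightarrow> real) set" where
  "eigenspace \<mu> = {f. supp_S f \<and> oper f = (\<lambda>x. \<mu> * f x)}"

lemma eigenspace_coefficient:
  assumes E: "eigensystem m u l" and "i < m" "f \<in> eigenspace \<mu>" "l i \<noteq> \<mu>"
  shows "dot f (u i) = 0"
proof -
  have "\<mu> * dot f (u i) = dot (oper f) (u i)"
    using assms(3) by (simp add: eigenspace_def dot_scale_left)
  also have "\<dots> = l i * dot f (u i)"
    by (simp add: oper_symmetric eigensystemD(2)[OF E \<open>i < m\<close>] dot_scale_right)
  finally show ?thesis using assms(4) by simp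
qed

lemma eigensystem_inj:
  assumes E: "eigensystem m u l"
  shows "inj_on u {..<m}"
proof (rule inj_onI)
  fix i j assume "i \<in> {..<m}" "j \<in> {..<m}" "u i = u j"
  then have "dot (u i) (u j) = 1" using eigensystemD(3)[OF E, of i i] by simp
  then show "i = j"
    using eigensystemD(3)[OF E, of i j] \<open>i \<in> _\<close> \<open>j \<in> _\<close> by (simp split: if_splits)
qed

text \<open>The \<open>u i\<close> with \<open>l i = \<mu>\<close> form a basis: in the expansion of
  an eigenfunction all other coefficients vanish, and orthonormality gives independence.\<close>

lemma dim_eigenspace:
  assumes E: "eigensystem (card S) u l"
  shows "fun_space.dim (eigenspace \<mu>) = card {i. i < card S \<and> l i = \<mu>}"
proof (rule fun_space.dim_unique)
  let ?I = "{i. i < card S \<and> l i = \<mu>}"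
  have inj: "inj_on u ?I"
    by (rule inj_on_subset[OF eigensystem_inj[OF E]]) auto
  show "u ` ?I \<subseteq> eigenspace \<mu>"
    using eigensystemD[OF E] by (auto simp: eigenspace_def)
  show "card (u ` ?I) = card ?I"
    using inj by (rule card_image)
  show "eigenspace \<mu> \<subseteq> fun_space.span (u ` ?I)"
  proof
    fix f assume f: "f \<in> eigenspace \<mu>"
    have "f x = (\<Sum>i\<in>?I. dot f (u i) * u i x)" for x
    proof -
      have "f x = (\<Sum>i<card S. dot f (u i) * u i x)"
      proof (cases "x \<in> S")
        case False
        then show ?thesis
          using f eigensystemD(1)[OF E] by (simp add: eigenspace_def supp_S_def)
      qed (rule eigensystem_expand[OF E])
      also have "\<dots> = (\<Sum>i\<in>?I. dot f (u i) * u i x)"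
        using eigenspace_coefficient[OF E _ f] by (intro sum.mono_neutral_right) auto
      finally show ?thesis .
    qed
    then have "f = (\<Sum>i\<in>?I. (\<lambda>x. dot f (u i) * u i x))"
      by (simp add: fun_eq_iff sum_fun_apply)
    also have "\<dots> \<in> fun_space.span (u ` ?I)"
      by (intro fun_space.span_sum fun_space.span_scale fun_space.span_base) auto
    finally show "f \<in> fun_space.span (u ` ?I)" .
  qed
  show "fun_space.independent (u ` ?I)"
    unfolding fun_space.independent_explicit_module
  proof (intro allI impI)
    fix t c v
    assume t: "finite t" "t \<subseteq> u ` ?I" "(\<Sum>v\<in>t. (\<lambda>x. c v * v x)) = 0" "v \<in> t"
    then obtain j where j: "j < card S" "v = u j" by blast
    \<comment> \<open>Pairing the vanishing combination with \<open>v\<close> isolates the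
      coefficient \<open>c v\<close>.\<close>
    have "0 = dot (\<lambda>x. \<Sum>v\<in>t. c v * v x) v"
      using fun_cong[OF t(3)] by (simp add: sum_fun_apply dot_def)
    also have "\<dots> = (\<Sum>w\<in>t. c w * dot w v)"
      by (simp add: dot_sum_left dot_scale_left)
    also have "\<dots> = (\<Sum>w\<in>t. if w = v then c w else 0)"
      using t(2) j eigensystemD(3)[OF E] by (intro sum.cong) auto
    also have "\<dots> = c v" using t by simp
    finally show "c v = 0" by simp
  qed
qed

lemma eigenspace_nontrivial_iff:
  assumes E: "eigensystem (card S) u l"
  shows "(\<exists>f\<in>eigenspace \<mu>. f \<noteq> (\<lambda>x. 0)) \<longleftrightarrow> \<mu> \<in> l ` {..<card S}"
proof
  assume "\<exists>f\<in>eigenspace \<mu>. f \<noteq> (\<lambda>x. 0)"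
  then obtain f where f: "f \<in> eigenspace \<mu>" "f \<noteq> (\<lambda>x. 0)" by blast
  show "\<mu> \<in> l ` {..<card S}"
  proof (rule ccontr)
    assume "\<mu> \<notin> l ` {..<card S}"
    then have "dot f (u i) = 0" if "i < card S" for i
      using eigenspace_coefficient[OF E that f(1)] that by auto
    then have "f x = 0" if "x \<in> S" for x
      using eigensystem_expand[OF E that, of f] by simp
    then show False using f by (auto simp: eigenspace_def supp_S_def)
  qed
next
  assume "\<mu> \<in> l ` {..<card S}"
  then obtain i where i: "i < card S" "\<mu> = l i" by auto
  moreover have "u i \<noteq> (\<lambda>x. 0)"
    using eigensystemD(3)[OF E i(1) i(1)] by (auto simp: dot_def)
  ultimately show "\<exists>f\<in>eigenspace \<mu>. f \<noteq> (\<lambda>x. 0)"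
    using eigensystemD[OF E i(1)] by (auto simp: eigenspace_def)
qed

end

section \<open>The Harrell--Stubbe inequality\<close>

text \<open>The difference of the two sides is the double sum of \<open>d i j\<close>. It is
  antisymmetric, so the block with both indices below \<open>k\<close> cancels; for
  \<open>i < k \<le> j\<close> the factor \<open>\<Lambda> - l j\<close> is nonpositive and the
  others are nonnegative.\<close>

lemma harrell_stubbe_sum:
  fixes l :: "nat \<Rightarrow> real"
  assumes "k \<le> N" and l: "\<And>i. i < k \<Longrightarrow> l i \<le> \<Lambda>" "\<And>j. k \<le> j \<Longrightarrow> j < N \<Longrightarrow> \<Lambda> \<le> l j"
    and w: "\<And>i j. i < N \<Longrightarrow> j < N \<Longrightarrow> 0 \<le> w i j" "\<And>i j. i < N \<Longrightarrow> j < N \<Longrightarrow> w i j = w j i"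
  shows "(\<Sum>i<k. (\<Lambda> - l i)\<^sup>2 * (\<Sum>j<N. (l j - l i) * w i j))
    \<le> (\<Sum>i<k. (\<Lambda> - l i) * (\<Sum>j<N. (l i - l j)\<^sup>2 * w i j))"
proof -
  define d where "d i j = (\<Lambda> - l i) * (\<Lambda> - l j) * (l j - l i) * w i j" for i j
  have "(\<Sum>i<k. (\<Lambda> - l i)\<^sup>2 * (\<Sum>j<N. (l j - l i) * w i j))
      - (\<Sum>i<k. (\<Lambda> - l i) * (\<Sum>j<N. (l i - l j)\<^sup>2 * w i j))
    = (\<Sum>i<k. \<Sum>j<N. d i j)"
    unfolding sum_distrib_left sum_subtractf[symmetric] d_def
    by (intro sum.cong refl) (simp add: algebra_simps power2_eq_square)
  also have "\<dots> = (\<Sum>i<k. \<Sum>j<k. d i j) + (\<Sum>i<k. \<Sum>j=k..<N. d i j)"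
  proof -
    have "{..<N} = {..<k} \<union> {k..<N}" using \<open>k \<le> N\<close> by auto
    then have "(\<Sum>j<N. d i j) = (\<Sum>j<k. d i j) + (\<Sum>j=k..<N. d i j)" for i
      by (simp add: sum.union_disjoint ivl_disj_int)
    then show ?thesis by (simp add: sum.distrib)
  qed
  also have "(\<Sum>i<k. \<Sum>j<k. d i j) = 0"
  proof -
    have "(\<Sum>i<k. \<Sum>j<k. d i j) = (\<Sum>i<k. \<Sum>j<k. d j i)" by (rule sum.swap)
    also have "\<dots> = (\<Sum>i<k. \<Sum>j<k. - d i j)"
      using w(2) \<open>k \<le> N\<close> by (intro sum.cong refl) (simp add: d_def algebra_simps)
    finally show ?thesis by (simp add: sum_negf)
  qed
  also have "(\<Sum>i<k. \<Sum>j=k..<N. d i j) \<le> 0"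
  proof (intro sum_nonpos)
    fix i j assume "i \<in> {..<k}" "j \<in> {k..<N}"
    then have "l i \<le> \<Lambda>" "\<Lambda> \<le> l j" "0 \<le> w i j" using l w(1) \<open>k \<le> N\<close> by auto
    then show "d i j \<le> 0"
      unfolding d_def
      by (intro mult_nonpos_nonneg mult_nonneg_nonpos) auto
  qed
  finally show ?thesis by simp
qed

section \<open>Commutators with multiplication operators\<close>

context symmetric_kernel
begin

text \<open>On \<open>S\<close> this is \<open>g\<close> times \<open>oper f\<close> minus
  \<open>oper\<close> of the product of \<open>g\<close> and \<open>f\<close>. It is not cut off
  outside \<open>S\<close>; only its values on \<open>S\<close> enter.\<close>

definition commutator :: "('a \<Rightarrow> real) \<Rightarrow> ('a \<Rightarrow> real) \<Rightarrow> 'a \<Rightarrow> real" where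
  "commutator g f x = (\<Sum>y\<in>S. (g x - g y) * K x y * f y)"

text \<open>Exchanging \<open>x\<close> and \<open>y\<close> and averaging, with \<open>K\<close>
  symmetric, completes the single factor \<open>g x\<close> to the second factor
  \<open>g x - g y\<close>.\<close>

lemma dot_commutator_multiplier:
  "dot (commutator g f) (\<lambda>x. g x * f x)
    = (1 / 2) * (\<Sum>x\<in>S. \<Sum>y\<in>S. (g x - g y)\<^sup>2 * K x y * f x * f y)"
proof -
  define T where "T = dot (commutator g f) (\<lambda>x. g x * f x)"
  have 1: "T = (\<Sum>x\<in>S. \<Sum>y\<in>S. (g x - g y) * g x * K x y * f x * f y)"
    unfolding T_def dot_def commutator_def sum_distrib_right by (simp add: mult_ac)
  also have "\<dots> = (\<Sum>x\<in>S. \<Sum>y\<in>S. (g y - g x) * g y * K x y * f x * f y)"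
    by (subst sum.swap) (intro sum.cong refl, simp add: sym)
  finally have "2 * T = (\<Sum>x\<in>S. \<Sum>y\<in>S. (g x - g y) * g x * K x y * f x * f y)
      + (\<Sum>x\<in>S. \<Sum>y\<in>S. (g y - g x) * g y * K x y * f x * f y)"
    using 1 by linarith
  also have "\<dots> = (\<Sum>x\<in>S. \<Sum>y\<in>S. (g x - g y)\<^sup>2 * K x y * f x * f y)"
    unfolding sum.distrib[symmetric]
    by (intro sum.cong refl) (simp add: algebra_simps power2_eq_square)
  finally show ?thesis by (simp add: T_def)
qed

lemma dot_commutator_eigenfunctions:
  assumes E: "eigensystem m u l" and "i < m" "j < m"
  shows "dot (commutator g (u i)) (u j) = (l i - l j) * dot (\<lambda>x. g x * u i x) (u j)"
proof -
  have "commutator g (u i) x = l i * (g x * u i x) - oper (\<lambda>y. g y * u i y) x" if "x \<in> S" for x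
  proof -
    have "commutator g (u i) x = g x * oper (u i) x - oper (\<lambda>y. g y * u i y) x"
      using that unfolding commutator_def oper_def
      by (simp add: sum_distrib_left sum_subtractf[symmetric] algebra_simps)
    then show ?thesis by (simp add: eigensystemD(2)[OF E \<open>i < m\<close>])
  qed
  then have "dot (commutator g (u i)) (u j)
      = dot (\<lambda>x. l i * (g x * u i x) - oper (\<lambda>y. g y * u i y) x) (u j)"
    by (simp add: dot_def)
  also have "\<dots> = l i * dot (\<lambda>x. g x * u i x) (u j) - dot (\<lambda>x. g x * u i x) (oper (u j))"
    by (simp only: dot_diff_left dot_scale_left oper_symmetric)
  finally show ?thesis
    by (simp add: eigensystemD(2)[OF E \<open>j < m\<close>] dot_scale_right left_diff_distrib)
qed

text \<open>\<open>harrell_stubbe_sum\<close> is applied with weights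
  \<open>(a i j)\<^sup>2\<close>; they are symmetric because multiplication by \<open>g\<close> is a
  symmetric operator.\<close>

lemma harrell_stubbe:
  assumes E: "eigensystem (card S) u l" and "k \<le> card S"
    and "\<And>i. i < k \<Longrightarrow> l i \<le> \<Lambda>" "\<And>j. k \<le> j \<Longrightarrow> j < card S \<Longrightarrow> \<Lambda> \<le> l j"
  shows "(\<Sum>i<k. (\<Lambda> - l i)\<^sup>2 * (- (1 / 2) * (\<Sum>x\<in>S. \<Sum>y\<in>S. (g x - g y)\<^sup>2 * K x y * u i x * u i y)))
    \<le> (\<Sum>i<k. (\<Lambda> - l i) * (\<Sum>x\<in>S. (commutator g (u i) x)\<^sup>2))"
proof -
  define a where "a i j = dot (\<lambda>x. g x * u i x) (u j)" for i j
  have a_sym: "a i j = a j i" for i j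
    by (simp add: a_def dot_def mult_ac)
  have c1: "(\<Sum>x\<in>S. (commutator g (u i) x)\<^sup>2) = (\<Sum>j<card S. (l i - l j)\<^sup>2 * (a i j)\<^sup>2)"
    if "i < k" for i
  proof -
    have "(\<Sum>x\<in>S. (commutator g (u i) x)\<^sup>2) = dot (commutator g (u i)) (commutator g (u i))"
      by (simp add: dot_def power2_eq_square)
    also have "\<dots> = (\<Sum>j<card S. (l i - l j)\<^sup>2 * (a i j)\<^sup>2)"
      using that \<open>k \<le> card S\<close>
      by (subst parseval[OF E], intro sum.cong refl)
        (auto simp: dot_commutator_eigenfunctions[OF E] a_def power2_eq_square)
    finally show ?thesis .
  qed
  have c2: "- (1 / 2) * (\<Sum>x\<in>S. \<Sum>y\<in>S. (g x - g y)\<^sup>2 * K x y * u i x * u i y)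
      = (\<Sum>j<card S. (l j - l i) * (a i j)\<^sup>2)" if "i < k" for i
  proof -
    have "- (1 / 2) * (\<Sum>x\<in>S. \<Sum>y\<in>S. (g x - g y)\<^sup>2 * K x y * u i x * u i y)
        = - dot (commutator g (u i)) (\<lambda>x. g x * u i x)"
      by (simp add: dot_commutator_multiplier)
    also have "\<dots> = - (\<Sum>j<card S. (l i - l j) * (a i j)\<^sup>2)"
      using that \<open>k \<le> card S\<close>
      by (subst parseval[OF E], intro arg_cong[where f = uminus] sum.cong refl)
        (auto simp: dot_commutator_eigenfunctions[OF E] a_def power2_eq_square)
    also have "\<dots> = (\<Sum>j<card S. (l j - l i) * (a i j)\<^sup>2)"
      by (simp add: sum_negf[symmetric] algebra_simps)
    finally show ?thesis .
  qed
  have "(\<Sum>i<k. (\<Lambda> - l i)\<^sup>2 * (\<Sum>j<card S. (l j - l i) * (a i j)\<^sup>2))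
      \<le> (\<Sum>i<k. (\<Lambda> - l i) * (\<Sum>j<card S. (l i - l j)\<^sup>2 * (a i j)\<^sup>2))"
    using assms(2-4) by (rule harrell_stubbe_sum) (simp_all add: a_sym)
  moreover have "(\<Sum>i<k. (\<Lambda> - l i)\<^sup>2 * (- (1 / 2) *
      (\<Sum>x\<in>S. \<Sum>y\<in>S. (g x - g y)\<^sup>2 * K x y * u i x * u i y)))
    = (\<Sum>i<k. (\<Lambda> - l i)\<^sup>2 * (\<Sum>j<card S. (l j - l i) * (a i j)\<^sup>2))"
    by (intro sum.cong refl arg_cong2[where f = "(*)"]) (rule c2, simp)
  moreover have "(\<Sum>i<k. (\<Lambda> - l i) * (\<Sum>x\<in>S. (commutator g (u i) x)\<^sup>2))
    = (\<Sum>i<k. (\<Lambda> - l i) * (\<Sum>j<card S. (l i - l j)\<^sup>2 * (a i j)\<^sup>2))"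
    by (intro sum.cong refl arg_cong2[where f = "(*)"]) (rule c1, simp)
  ultimately show ?thesis by (simp only:)
qed

end

section \<open>Coordinate functions on the integer lattice\<close>

lemma sum_swap_into_double:
  "(\<Sum>p\<in>P. \<Sum>x\<in>A. \<Sum>y\<in>B x. F p x y) = (\<Sum>x\<in>A. \<Sum>y\<in>B x. \<Sum>p\<in>P. F p x y)"
  by (subst sum.swap, intro sum.cong refl, rule sum.swap)

lemma lattice_adj_commute: "lattice_adj x y \<longleftrightarrow> lattice_adj y x"
  by (simp add: lattice_adj_def abs_minus_commute)

lemma not_lattice_adj_self [simp]: "\<not> lattice_adj x x"
  by (simp add: lattice_adj_def)

lemma card_lattice_neighbours: "card {y. lattice_adj (x :: int ^ 'n) y} = 2 * CARD('n)"
  using lattice_degree_eq[of x] by (simp add: lattice_degree_def)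

lemma finite_lattice_neighbours: "finite {y. lattice_adj (x :: int ^ 'n) y}"
  by (rule card_ge_0_finite) (simp add: card_lattice_neighbours)

lemma lattice_adj_coordinate:
  assumes "lattice_adj x y"
  shows "\<bar>x $ p - y $ p\<bar> = 0 \<or> \<bar>x $ p - y $ p\<bar> = 1"
proof -
  have "\<bar>x $ p - y $ p\<bar> \<le> (\<Sum>i\<in>UNIV. \<bar>x $ i - y $ i\<bar>)"
    by (rule member_le_sum) auto
  then show ?thesis using assms by (auto simp: lattice_adj_def)
qed

lemma lattice_adj_coordinate_abs_square:
  assumes "lattice_adj x y"
  shows "(real_of_int (x $ p - y $ p))\<^sup>2 = \<bar>real_of_int (x $ p - y $ p)\<bar>"
proof -
  have "x $ p - y $ p \<in> {0, 1, -1}" using lattice_adj_coordinate[OF assms, of p] by auto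
  then show ?thesis by (auto simp del: of_int_diff)
qed

text \<open>Coordinate differences of neighbours are 0, 1 or -1, so their squares are absolute
  values and add up to the lattice distance.\<close>

lemma sum_coordinate_squares:
  assumes "lattice_adj x y"
  shows "(\<Sum>p\<in>UNIV. (real_of_int (x $ p - y $ p))\<^sup>2) = 1"
proof -
  have "(\<Sum>p\<in>UNIV. (real_of_int (x $ p - y $ p))\<^sup>2) = real_of_int (\<Sum>p\<in>UNIV. \<bar>x $ p - y $ p\<bar>)"
    unfolding lattice_adj_coordinate_abs_square[OF assms] by simp
  also have "\<dots> = 1"
    using assms by (simp only: lattice_adj_def of_int_1)
  finally show ?thesis .
qed

lemma lattice_adj_eq_axis:
  assumes "lattice_adj x y" "x $ p \<noteq> y $ p"
  shows "y \<in> {x + axis p 1, x - axis p 1}"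
proof -
  have d: "\<bar>x $ p - y $ p\<bar> = 1"
    using lattice_adj_coordinate[OF assms(1), of p] assms(2) by auto
  have "(\<Sum>i\<in>UNIV. \<bar>x $ i - y $ i\<bar>) = \<bar>x $ p - y $ p\<bar> + (\<Sum>i\<in>UNIV - {p}. \<bar>x $ i - y $ i\<bar>)"
    by (rule sum.remove) auto
  then have "(\<Sum>i\<in>UNIV - {p}. \<bar>x $ i - y $ i\<bar>) = 0"
    using assms(1) d by (simp add: lattice_adj_def)
  then have "\<forall>i\<in>UNIV - {p}. \<bar>x $ i - y $ i\<bar> = 0"
    by (subst (asm) sum_nonneg_eq_0_iff) auto
  then have eq: "y $ i = x $ i" if "i \<noteq> p" for i using that by simp
  have "y $ p = x $ p + 1 \<or> y $ p = x $ p - 1" using d by auto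
  then show ?thesis
    using eq by (auto simp: vec_eq_iff axis_def)
qed

text \<open>Only neighbours displaced along axis \<open>p\<close> contribute; there are at most two,
  each contributing at most 1.\<close>

lemma sum_neighbours_coordinate_square_le:
  "(\<Sum>y | lattice_adj x y. (real_of_int (x $ p - y $ p))\<^sup>2) \<le> 2"
proof -
  let ?P = "{x + axis p 1, x - axis p 1}"
  have "(\<Sum>y | lattice_adj x y. (real_of_int (x $ p - y $ p))\<^sup>2)
      = (\<Sum>y\<in>{y. lattice_adj x y} \<inter> ?P. (real_of_int (x $ p - y $ p))\<^sup>2)"
    using lattice_adj_eq_axis[of x _ p]
    by (intro sum.mono_neutral_right finite_lattice_neighbours) auto
  also have "\<dots> \<le> (\<Sum>y\<in>{y. lattice_adj x y} \<inter> ?P. 1)"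
    by (intro sum_mono) (auto simp: axis_def)
  also have "\<dots> \<le> real (card ?P)"
    by (simp del: card_insert_if add: card_mono)
  also have "\<dots> \<le> 2"
    by (simp add: card_insert_if)
  finally show ?thesis .
qed

lemma sum_neighbours_coordinate:
  "(\<Sum>y | lattice_adj x y. real_of_int (x $ p - y $ p)) = 0"
proof -
  have "(\<Sum>y | lattice_adj x y. real_of_int (x $ p - y $ p))
      = (\<Sum>y | lattice_adj x y. - real_of_int (x $ p - y $ p))"
    \<comment> \<open>Reflection in \<open>x\<close> permutes the neighbours and reverses every
      coordinate difference.\<close>
    by (rule sum.reindex_bij_witness[of _ "\<lambda>y. x + x - y" "\<lambda>y. x + x - y"])
      (auto simp: lattice_adj_def abs_minus_commute)
  then show ?thesis unfolding sum_negf by linarith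
qed

text \<open>Since the coordinate differences add up to 0, \<open>f y\<close> may be replaced by
  \<open>f y - f x\<close>, which brings in the Dirichlet energy. The constant 2 bounds the first
  Cauchy--Schwarz factor.\<close>

lemma neighbour_difference_square_le:
  "(\<Sum>y | lattice_adj x y. real_of_int (x $ p - y $ p) * f y)\<^sup>2
    \<le> 2 * (\<Sum>y | lattice_adj x y. (real_of_int (x $ p - y $ p))\<^sup>2 * (f y - f x)\<^sup>2)"
proof -
  let ?N = "{y. lattice_adj x y}" and ?d = "\<lambda>y. real_of_int (x $ p - y $ p)"
  have "(\<Sum>y\<in>?N. ?d y * f y) = (\<Sum>y\<in>?N. ?d y * f y) - (\<Sum>y\<in>?N. ?d y) * f x"
    unfolding sum_neighbours_coordinate by simp
  also have "\<dots> = (\<Sum>y\<in>?N. ?d y * (f y - f x))"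
    unfolding sum_distrib_right sum_subtractf[symmetric] right_diff_distrib ..
  \<comment> \<open>As \<open>?d y\<close> is 0, 1 or -1, the extra factor \<open>\<bar>?d y\<bar>\<close> keeps the weight in both Cauchy--Schwarz factors.\<close>
  also have "\<dots> = (\<Sum>y\<in>?N. ?d y * (\<bar>?d y\<bar> * (f y - f x)))"
  proof (intro sum.cong refl)
    fix y assume "y \<in> ?N"
    then have "x $ p - y $ p \<in> {0, 1, -1}" using lattice_adj_coordinate[of x y p] by auto
    then show "?d y * (f y - f x) = ?d y * (\<bar>?d y\<bar> * (f y - f x))" by auto
  qed
  finally have "(\<Sum>y\<in>?N. ?d y * f y)\<^sup>2 = (\<Sum>y\<in>?N. ?d y * (\<bar>?d y\<bar> * (f y - f x)))\<^sup>2"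
    by simp
  also have "\<dots> \<le> (\<Sum>y\<in>?N. (?d y)\<^sup>2) * (\<Sum>y\<in>?N. (\<bar>?d y\<bar> * (f y - f x))\<^sup>2)"
    by (rule Cauchy_Schwarz_ineq_sum)
  also have "\<dots> \<le> 2 * (\<Sum>y\<in>?N. (\<bar>?d y\<bar> * (f y - f x))\<^sup>2)"
    by (intro mult_right_mono sum_neighbours_coordinate_square_le sum_nonneg) auto
  finally show ?thesis by (simp only: power_mult_distrib power2_abs)
qed

section \<open>The Dirichlet Laplacian as a symmetric kernel\<close>

locale lattice_domain =
  fixes \<Omega> :: "(int ^ 'n) set"
  assumes finite_domain: "finite \<Omega>"
begin

text \<open>The matrix of minus the Dirichlet Laplacian; extension by zero amounts to restricting
  both indices to \<open>\<Omega>\<close>.\<close>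

definition kernel :: "int ^ 'n \<Rightarrow> int ^ 'n \<Rightarrow> real" where
  "kernel x y = of_bool (x = y) - of_bool (lattice_adj x y) / (2 * real CARD('n))"

sublocale symmetric_kernel \<Omega> kernel
  using finite_domain by unfold_locales (auto simp: kernel_def lattice_adj_commute)

lemma sum_neighbours:
  fixes h :: "int ^ 'n \<Rightarrow> real"
  assumes "\<And>y. y \<notin> \<Omega> \<Longrightarrow> h y = 0"
  shows "(\<Sum>y | lattice_adj x y. h y) = (\<Sum>y\<in>\<Omega>. of_bool (lattice_adj x y) * h y)"
proof -
  have "(\<Sum>y | lattice_adj x y. h y) = (\<Sum>y\<in>{y. lattice_adj x y} \<inter> \<Omega>. h y)"
    using assms by (intro sum.mono_neutral_right finite_lattice_neighbours) auto
  also have "\<dots> = (\<Sum>y\<in>\<Omega>. of_bool (lattice_adj x y) * h y)"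
    using finite_domain by (intro sum.mono_neutral_cong_left) auto
  finally show ?thesis .
qed

lemma oper_eq:
  assumes "supp_S f" "x \<in> \<Omega>"
  shows "oper f x = f x - (\<Sum>y | lattice_adj x y. f y) / (2 * real CARD('n))"
proof -
  have "oper f x = (\<Sum>y\<in>\<Omega>. of_bool (x = y) * f y)
      - (\<Sum>y\<in>\<Omega>. of_bool (lattice_adj x y) * f y) / (2 * real CARD('n))"
    using assms(2)
    by (simp only: oper_def kernel_def left_diff_distrib sum_subtractf if_True
        sum_divide_distrib times_divide_eq_left)
  then show ?thesis
    using assms finite_domain sum_neighbours[of f x] by (simp add: supp_S_def)
qed

lemma dirichlet_eigenspace_eq: "dirichlet_eigenspace \<Omega> \<mu> = eigenspace \<mu>"
proof -
  have "- dirichlet_laplacian \<Omega> f x = oper f x" if "supp_S f" "x \<in> \<Omega>" for f x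
  proof -
    have "zero_extension \<Omega> f = f"
      using that(1) by (auto simp: zero_extension_def supp_S_def)
    then show ?thesis
      using that by (simp add: oper_eq dirichlet_laplacian_def lattice_laplacian_def lattice_degree_eq)
  qed
  moreover have "oper f x = \<mu> * f x" if "supp_S f" "x \<notin> \<Omega>" for f x
    using that by (simp add: supp_S_def oper_def)
  ultimately show ?thesis
    unfolding dirichlet_eigenspace_def eigenspace_def functions_on_def supp_S_def[symmetric]
    by (auto simp: fun_eq_iff) metis
qed

text \<open>Multiplicities count indices of the eigensystem, so the defining multiset is that of the
  values of \<open>l\<close>, already in order. \<open>Suc i\<close> reconciles the 1-based
  eigenvalues with the 0-based system.\<close>

lemma dirichlet_eigenvalue_eq:
  assumes E: "eigensystem (card \<Omega>) u l"
    and mono: "\<And>i j. i \<le> j \<Longrightarrow> j < card \<Omega> \<Longrightarrow> l i \<le> l j"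
    and "i < card \<Omega>"
  shows "dirichlet_eigenvalue \<Omega> (Suc i) = l i"
proof -
  let ?N = "card \<Omega>"
  have "dirichlet_spectrum \<Omega> = l ` {..<?N}"
    using eigenspace_nontrivial_iff[OF E] by (auto simp: dirichlet_spectrum_def dirichlet_eigenspace_eq)
  then have "dirichlet_eigenvalues \<Omega> = sorted_list_of_multiset (mset (map l [0..<?N]))"
    using sum_replicate_mset_card_vimage[of "{..<?N}" l]
    by (simp add: dirichlet_eigenvalues_def dirichlet_multiplicity_def dirichlet_eigenspace_eq
        dim_eigenspace[OF E] lessThan_atLeast0)
  also have "\<dots> = map l [0..<?N]"
    unfolding sorted_list_of_multiset_mset
    by (rule sort_key_id_if_sorted) (auto simp: sorted_iff_nth_mono intro!: mono)
  finally show ?thesis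
    using \<open>i < ?N\<close> by (simp add: dirichlet_eigenvalue_def)
qed

section \<open>Energy and commutator estimates\<close>

lemma sum_neighbour_products:
  assumes "supp_S f"
  shows "(\<Sum>x\<in>\<Omega>. \<Sum>y | lattice_adj x y. f x * f y) = 2 * real CARD('n) * (dot f f - dot (oper f) f)"
proof -
  have "dot (oper f) f = (\<Sum>x\<in>\<Omega>. f x * f x - (\<Sum>y | lattice_adj x y. f x * f y) / (2 * real CARD('n)))"
    unfolding dot_def using assms
    by (intro sum.cong refl) (simp add: oper_eq sum_distrib_left algebra_simps)
  then show ?thesis
    by (simp add: dot_def sum_subtractf sum_divide_distrib[symmetric])
qed

text \<open>After expanding the square, the terms \<open>(f x)\<^sup>2\<close> give exactly 2n times
  the squared norm. The terms \<open>(f y)\<^sup>2\<close> give at most that, because a vertex has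
  at most 2n neighbours inside \<open>\<Omega>\<close>.\<close>

lemma energy_le:
  assumes "supp_S f"
  shows "(\<Sum>x\<in>\<Omega>. \<Sum>y | lattice_adj x y. (f y - f x)\<^sup>2) \<le> 4 * real CARD('n) * dot (oper f) f"
proof -
  let ?n = "real CARD('n)"
  have "(\<Sum>x\<in>\<Omega>. \<Sum>y | lattice_adj x y. (f y)\<^sup>2)
      = (\<Sum>y\<in>\<Omega>. \<Sum>x\<in>\<Omega>. of_bool (lattice_adj y x) * (f y)\<^sup>2)"
    using assms by (subst sum.swap) (simp add: sum_neighbours supp_S_def lattice_adj_commute)
  also have "\<dots> \<le> (\<Sum>y\<in>\<Omega>. 2 * ?n * (f y)\<^sup>2)"
  proof (intro sum_mono)
    fix y
    have "real (card (\<Omega> \<inter> {x. lattice_adj y x})) \<le> real (card {x. lattice_adj y x})"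
      using finite_lattice_neighbours by (intro of_nat_mono card_mono) auto
    then have "(\<Sum>x\<in>\<Omega>. of_bool (lattice_adj y x)) \<le> 2 * ?n"
      using finite_domain by (simp add: card_lattice_neighbours)
    then show "(\<Sum>x\<in>\<Omega>. of_bool (lattice_adj y x) * (f y)\<^sup>2) \<le> 2 * ?n * (f y)\<^sup>2"
      unfolding sum_distrib_right[symmetric] by (rule mult_right_mono) auto
  qed
  finally have 1: "(\<Sum>x\<in>\<Omega>. \<Sum>y | lattice_adj x y. (f y)\<^sup>2) \<le> 2 * ?n * dot f f"
    by (simp add: dot_def sum_distrib_left power2_eq_square)
  have 2: "(\<Sum>x\<in>\<Omega>. \<Sum>y | lattice_adj x y. (f x)\<^sup>2) = 2 * ?n * dot f f"
    by (simp add: card_lattice_neighbours dot_def sum_distrib_left power2_eq_square)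
  have "(\<Sum>x\<in>\<Omega>. \<Sum>y | lattice_adj x y. (f y - f x)\<^sup>2)
      = (\<Sum>x\<in>\<Omega>. \<Sum>y | lattice_adj x y. (f y)\<^sup>2) + (\<Sum>x\<in>\<Omega>. \<Sum>y | lattice_adj x y. (f x)\<^sup>2)
        - 2 * (\<Sum>x\<in>\<Omega>. \<Sum>y | lattice_adj x y. f x * f y)"
    by (simp add: power2_diff sum.distrib sum_subtractf sum_distrib_left mult_ac)
  then show ?thesis
    using 1 2 by (simp add: sum_neighbour_products[OF assms] algebra_simps)
qed

text \<open>Summing over all coordinates turns the directional weights into 1 and leaves the full
  energy. The constant is 2/n = 2/(2n)^2 times the 4n of \<open>energy_le\<close>.\<close>

lemma sum_commutator_coordinates_le:
  assumes "supp_S f"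
  shows "(\<Sum>p\<in>UNIV. \<Sum>x\<in>\<Omega>. (commutator (\<lambda>x. real_of_int (x $ p)) f x)\<^sup>2)
    \<le> 2 / real CARD('n) * dot (oper f) f"
proof -
  let ?n = "real CARD('n)"
  have comm: "commutator (\<lambda>x. real_of_int (x $ p)) f x
      = - (\<Sum>y | lattice_adj x y. real_of_int (x $ p - y $ p) * f y) / (2 * ?n)" for p x
  proof -
    have "commutator (\<lambda>x. real_of_int (x $ p)) f x
        = (\<Sum>y\<in>\<Omega>. - (of_bool (lattice_adj x y) * (real_of_int (x $ p - y $ p) * f y)) / (2 * ?n))"
      unfolding commutator_def by (intro sum.cong refl) (auto simp: kernel_def)
    also have "\<dots> = - (\<Sum>y\<in>\<Omega>. of_bool (lattice_adj x y) * (real_of_int (x $ p - y $ p) * f y)) / (2 * ?n)"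
      by (simp only: sum_divide_distrib[symmetric] sum_negf)
    also have "\<dots> = - (\<Sum>y | lattice_adj x y. real_of_int (x $ p - y $ p) * f y) / (2 * ?n)"
      using assms by (subst sum_neighbours) (auto simp: supp_S_def)
    finally show ?thesis .
  qed
  have "(\<Sum>p\<in>UNIV. \<Sum>x\<in>\<Omega>. (commutator (\<lambda>x. real_of_int (x $ p)) f x)\<^sup>2)
      \<le> (\<Sum>p\<in>UNIV. \<Sum>x\<in>\<Omega>. 2 * (\<Sum>y | lattice_adj x y. (real_of_int (x $ p - y $ p))\<^sup>2 * (f y - f x)\<^sup>2)
          / (2 * ?n)\<^sup>2)"
    unfolding comm power_divide power2_minus
    by (intro sum_mono divide_right_mono neighbour_difference_square_le) simp
  also have "\<dots> = 2 / (2 * ?n)\<^sup>2 *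
      (\<Sum>x\<in>\<Omega>. \<Sum>y | lattice_adj x y. (\<Sum>p\<in>UNIV. (real_of_int (x $ p - y $ p))\<^sup>2) * (f y - f x)\<^sup>2)"
    by (simp only: sum_distrib_left sum_distrib_right sum_divide_distrib times_divide_eq_left)
      (rule sum_swap_into_double)
  also have "\<dots> = 2 / (2 * ?n)\<^sup>2 * (\<Sum>x\<in>\<Omega>. \<Sum>y | lattice_adj x y. (f y - f x)\<^sup>2)"
    by (simp add: sum_coordinate_squares del: of_int_diff)
  also have "\<dots> \<le> 2 / (2 * ?n)\<^sup>2 * (4 * ?n * dot (oper f) f)"
    by (intro mult_left_mono energy_le assms) simp
  also have "\<dots> = 2 / ?n * dot (oper f) f"
    by (simp add: power2_eq_square field_simps)
  finally show ?thesis .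
qed

text \<open>
  The diagonal of the kernel is killed by the coordinate differences, so only the adjacency
  part survives.
\<close>

lemma sum_double_commutator_coordinates:
  assumes "supp_S f"
  shows "(\<Sum>p\<in>UNIV. - (1 / 2) * (\<Sum>x\<in>\<Omega>. \<Sum>y\<in>\<Omega>.
      (real_of_int (x $ p) - real_of_int (y $ p))\<^sup>2 * kernel x y * f x * f y))
    = (dot f f - dot (oper f) f) / 2"
proof -
  let ?n = "real CARD('n)"
  have "(\<Sum>p\<in>UNIV. - (1 / 2) * (\<Sum>x\<in>\<Omega>. \<Sum>y\<in>\<Omega>.
      (real_of_int (x $ p) - real_of_int (y $ p))\<^sup>2 * kernel x y * f x * f y))
    = - (1 / 2) * (\<Sum>x\<in>\<Omega>. \<Sum>y\<in>\<Omega>.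
      (\<Sum>p\<in>UNIV. (real_of_int (x $ p - y $ p))\<^sup>2) * kernel x y * f x * f y)"
    unfolding sum_distrib_left[symmetric]
    by (subst sum_swap_into_double) (simp only: sum_distrib_right of_int_diff)
  also have "(\<Sum>x\<in>\<Omega>. \<Sum>y\<in>\<Omega>.
      (\<Sum>p\<in>UNIV. (real_of_int (x $ p - y $ p))\<^sup>2) * kernel x y * f x * f y)
    = (\<Sum>x\<in>\<Omega>. \<Sum>y\<in>\<Omega>. - (of_bool (lattice_adj x y) * (f x * f y)) / (2 * ?n))"
    by (intro sum.cong refl) (auto simp: kernel_def sum_coordinate_squares simp del: of_int_diff)
  also have "\<dots> = - (\<Sum>x\<in>\<Omega>. \<Sum>y | lattice_adj x y. f x * f y) / (2 * ?n)"
    using assms by (simp add: sum_neighbours supp_S_def sum_divide_distrib sum_negf)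
  also have "- (1 / 2) * \<dots> = (dot f f - dot (oper f) f) / 2"
    by (simp add: sum_neighbour_products[OF assms] field_simps)
  finally show ?thesis .
qed

section \<open>Yang's first inequality and the trace bound\<close>

lemma yang_first:
  assumes E: "eigensystem (card \<Omega>) u l" and "k \<le> card \<Omega>"
    and l: "\<And>i. i < k \<Longrightarrow> l i \<le> \<Lambda>" "\<And>j. k \<le> j \<Longrightarrow> j < card \<Omega> \<Longrightarrow> \<Lambda> \<le> l j"
  shows "(\<Sum>i<k. (\<Lambda> - l i)\<^sup>2 * (1 - l i)) \<le> 4 / real CARD('n) * (\<Sum>i<k. (\<Lambda> - l i) * l i)"
proof -
  let ?n = "real CARD('n)"
  let ?g = "\<lambda>p (x :: int ^ 'n). real_of_int (x $ p)"
  have supp: "supp_S (u i)" and self: "dot (u i) (u i) = 1" "dot (oper (u i)) (u i) = l i" if "i < k" for i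
    using that \<open>k \<le> card \<Omega>\<close> eigensystemD[OF E, of i] by (simp_all add: dot_scale_left)
  \<comment> \<open>Summed over coordinates, the double commutator at \<open>u i\<close> equals
    \<open>(1 - l i) / 2\<close>, while the squared commutator norms are at most 2/n times
    \<open>l i\<close>. Clearing the half produces the constant 4/n.\<close>
  have "(\<Sum>i<k. (\<Lambda> - l i)\<^sup>2 * ((1 - l i) / 2))
      = (\<Sum>i<k. (\<Lambda> - l i)\<^sup>2 * (\<Sum>p\<in>UNIV. - (1 / 2) * (\<Sum>x\<in>\<Omega>. \<Sum>y\<in>\<Omega>.
          (?g p x - ?g p y)\<^sup>2 * kernel x y * u i x * u i y)))"
    by (intro sum.cong refl) (simp only: sum_double_commutator_coordinates supp self lessThan_iff)
  also have "\<dots> = (\<Sum>p\<in>UNIV. \<Sum>i<k. (\<Lambda> - l i)\<^sup>2 * (- (1 / 2) * (\<Sum>x\<in>\<Omega>. \<Sum>y\<in>\<Omega>.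
          (?g p x - ?g p y)\<^sup>2 * kernel x y * u i x * u i y)))"
    by (subst sum.swap) (simp only: sum_distrib_left)
  also have "\<dots> \<le> (\<Sum>p\<in>UNIV. \<Sum>i<k. (\<Lambda> - l i) * (\<Sum>x\<in>\<Omega>. (commutator (?g p) (u i) x)\<^sup>2))"
    using assms by (intro sum_mono harrell_stubbe)
  also have "\<dots> = (\<Sum>i<k. (\<Lambda> - l i) * (\<Sum>p\<in>UNIV. \<Sum>x\<in>\<Omega>. (commutator (?g p) (u i) x)\<^sup>2))"
    by (subst sum.swap) (simp only: sum_distrib_left)
  also have "\<dots> \<le> (\<Sum>i<k. (\<Lambda> - l i) * (2 / ?n * l i))"
    using sum_commutator_coordinates_le[OF supp] l(1)
    by (intro sum_mono mult_left_mono) (auto simp: self)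
  finally show ?thesis
    by (simp add: sum_distrib_left sum_divide_distrib[symmetric] mult_ac)
qed

text \<open>The energy is a sum of squares, so the upper bound for it forces the quadratic form to
  be nonnegative.\<close>

lemma eigenvalue_nonneg:
  assumes "eigensystem m u l" "i < m"
  shows "0 \<le> l i"
proof -
  have "0 \<le> 4 * real CARD('n) * dot (oper (u i)) (u i)"
    by (rule order_trans[OF _ energy_le[OF eigensystemD(1)[OF assms]]]) (intro sum_nonneg, simp)
  then show ?thesis
    using eigensystemD[OF assms] assms(2) by (simp add: dot_scale_left zero_le_mult_iff)
qed

lemma sum_one_minus_eigenvalues_nonneg:
  assumes E: "eigensystem (card \<Omega>) u l" and "k \<le> card \<Omega>"
    and l: "\<And>i. i < k \<Longrightarrow> l i \<le> \<Lambda>" "\<And>j. k \<le> j \<Longrightarrow> j < card \<Omega> \<Longrightarrow> \<Lambda> \<le> l j"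
  shows "0 \<le> (\<Sum>i<k. 1 - l i)"
proof (cases "\<Lambda> \<le> 1")
  case True
  then show ?thesis using l(1) by (intro sum_nonneg) force
next
  case False
  \<comment> \<open>No vertex is its own neighbour, so all diagonal entries are 1. Hence the numbers
    \<open>1 - l i\<close> add up to 0 over all indices, and those from \<open>k\<close> on are
    negative in this case.\<close>
  have "(\<Sum>i<card \<Omega>. l i) = card \<Omega>"
    unfolding trace_eq_sum_eigenvalues[OF E] by (simp add: kernel_def)
  then have "0 = (\<Sum>i<card \<Omega>. 1 - l i)" by (simp add: sum_subtractf)
  also have "{..<card \<Omega>} = {..<k} \<union> {k..<card \<Omega>}" using \<open>k \<le> card \<Omega>\<close> by auto
  also have "(\<Sum>i\<in>\<dots>. 1 - l i) = (\<Sum>i<k. 1 - l i) + (\<Sum>i=k..<card \<Omega>. 1 - l i)"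
    by (rule sum.union_disjoint) auto
  finally have "(\<Sum>i<k. 1 - l i) = - (\<Sum>i=k..<card \<Omega>. 1 - l i)" by simp
  moreover have "(\<Sum>i=k..<card \<Omega>. 1 - l i) \<le> 0"
    using l(2) False by (intro sum_nonpos) force
  ultimately show ?thesis by simp
qed

end

text \<open>Yang's first inequality says that the sum of \<open>(\<Lambda> - l i) * b i\<close> is
  nonpositive, and the conclusion says the same of the sum of \<open>b i\<close>. Chebyshev's
  inequality passes from one to the other.\<close>

lemma yang_second_of_first:
  fixes l :: "nat \<Rightarrow> real"
  assumes mono: "\<And>i j. i \<le> j \<Longrightarrow> j < k \<Longrightarrow> l i \<le> l j"
    and l: "\<And>i. i < k \<Longrightarrow> 0 \<le> l i" "\<And>i. i < k \<Longrightarrow> l i \<le> \<Lambda>"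
    and "0 \<le> c" "\<Lambda> \<le> 1 + c"
    and yang: "(\<Sum>i<k. (\<Lambda> - l i)\<^sup>2 * (1 - l i)) \<le> c * (\<Sum>i<k. (\<Lambda> - l i) * l i)"
  shows "\<Lambda> * (\<Sum>i<k. 1 - l i) \<le> (1 + c) * (\<Sum>i<k. l i) - (\<Sum>i<k. (l i)\<^sup>2)"
proof -
  \<comment> \<open>The negated weight is used because \<open>Chebyshev_sum_upper\<close> pairs an
    increasing sequence with a decreasing one.\<close>
  define a where "a i = l i - \<Lambda>" for i
  define b where "b i = (\<Lambda> - l i) * (1 - l i) - c * l i" for i
  have b_anti: "b j \<le> b i" if "i \<le> j" "j < k" for i j
  proof -
    have "b i - b j = (l j - l i) * (\<Lambda> + 1 + c - l i - l j)"
      by (simp add: b_def algebra_simps)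
    \<comment> \<open>The second factor is nonnegative because \<open>l i \<le> \<Lambda>\<close>
      and \<open>l j \<le> \<Lambda> \<le> 1 + c\<close>. This is where the upper bound on the next
      eigenvalue enters.\<close>
    also have "\<dots> \<ge> 0"
      using mono[OF that] l(2)[of i] l(2)[of j] that \<open>\<Lambda> \<le> 1 + c\<close>
      by (intro mult_nonneg_nonneg) auto
    finally show ?thesis by simp
  qed
  have "real k * (\<Sum>i<k. a i * b i) \<le> (\<Sum>i<k. a i) * (\<Sum>i<k. b i)"
    unfolding lessThan_atLeast0
    by (rule Chebyshev_sum_upper) (auto simp: a_def mono b_anti)
  moreover have "(\<Sum>i<k. a i * b i) = c * (\<Sum>i<k. (\<Lambda> - l i) * l i) - (\<Sum>i<k. (\<Lambda> - l i)\<^sup>2 * (1 - l i))"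
    unfolding sum_distrib_left sum_subtractf[symmetric] a_def b_def
    by (intro sum.cong refl) (simp add: algebra_simps power2_eq_square)
  ultimately have prod: "0 \<le> (\<Sum>i<k. a i) * (\<Sum>i<k. b i)"
    using yang by (smt (verit) mult_nonneg_nonneg of_nat_0_le_iff)
  have a: "a i \<le> 0" if "i < k" for i using l(2)[OF that] by (simp add: a_def)
  have "(\<Sum>i<k. b i) \<le> 0"
  \<comment> \<open>If all weights vanish, Chebyshev gives no information, but then
    \<open>b i = - c * l i\<close> is nonpositive directly.\<close>
  proof (cases "(\<Sum>i<k. a i) = 0")
    case True
    then have "\<forall>i<k. a i = 0"
      using a sum_nonneg_eq_0_iff[of "{..<k}" "\<lambda>i. - a i"] by (auto simp: sum_negf)
    then have "b i = - c * l i" if "i < k" for i using that by (simp add: a_def b_def)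
    then show ?thesis
      using l(1) \<open>0 \<le> c\<close> by (intro sum_nonpos) auto
  next
    case False
    then have "(\<Sum>i<k. a i) < 0"
      using sum_nonpos[of "{..<k}" a] a by (simp add: less_le)
    then show ?thesis using prod by (simp add: zero_le_mult_iff)
  qed
  moreover have "(\<Sum>i<k. b i) = \<Lambda> * (\<Sum>i<k. 1 - l i) - ((1 + c) * (\<Sum>i<k. l i) - (\<Sum>i<k. (l i)\<^sup>2))"
    unfolding sum_distrib_left sum_subtractf[symmetric] b_def
    by (intro sum.cong refl) (simp add: algebra_simps power2_eq_square)
  ultimately show ?thesis by simp
qed

theorem theorem1p5:
  fixes \<Omega> :: "(int ^ 'n) set" and k :: nat and ev :: "nat \<Rightarrow> real"
  defines "ev \<equiv> dirichlet_eigenvalue \<Omega>"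
  assumes "finite \<Omega>"
    and "1 \<le> k" and "k \<le> card \<Omega> - 1"
    and "ev (k + 1) \<le> 1 + 4 / real CARD('n)"
  shows "ereal (ev (k + 1)) \<le>
    (if (\<Sum>i=1..k. (1 - ev i)) = 0 then \<infinity>
     else ereal (((1 + 4 / real CARD('n)) * (\<Sum>i=1..k. ev i) - (\<Sum>i=1..k. (ev i)\<^sup>2))
                 / (\<Sum>i=1..k. (1 - ev i))))"
proof -
  let ?c = "4 / real CARD('n)"
  interpret lattice_domain \<Omega> by unfold_locales fact
  obtain u l where E: "eigensystem (card \<Omega>) u l"
    and mono: "\<And>i j. i \<le> j \<Longrightarrow> j < card \<Omega> \<Longrightarrow> l i \<le> l j"
    by (rule eigensystem_exists_sorted) blast
  \<comment> \<open>Truncated subtraction is harmless here: \<open>1 \<le> k\<close> rules out an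
    empty \<open>\<Omega>\<close>.\<close>
  have k: "k < card \<Omega>" using assms(3,4) by simp
  have ev: "ev (Suc i) = l i" if "i < card \<Omega>" for i
    unfolding ev_def using E mono that by (rule dirichlet_eigenvalue_eq)
  have sums: "(\<Sum>i=1..k. h (ev i)) = (\<Sum>i<k. h (l i))" for h :: "real \<Rightarrow> real"
    using k by (simp add: sum.atLeast1_atMost_eq ev)
  \<comment> \<open>With 0-based indices \<open>l k\<close> is the eigenvalue
    \<open>ev (k + 1)\<close>; it takes the role of \<open>\<Lambda>\<close>.\<close>
  have le: "l i \<le> l k" if "i < k" for i using mono that k by simp
  have ge: "l k \<le> l j" if "k \<le> j" "j < card \<Omega>" for j using mono that by simp
  have "0 \<le> (\<Sum>i<k. 1 - l i)"
    using sum_one_minus_eigenvalues_nonneg[OF E, of k "l k"] k le ge by simp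
  moreover have "l k * (\<Sum>i<k. 1 - l i) \<le> (1 + ?c) * (\<Sum>i<k. l i) - (\<Sum>i<k. (l i)\<^sup>2)"
  proof (rule yang_second_of_first)
    show "(\<Sum>i<k. (l k - l i)\<^sup>2 * (1 - l i)) \<le> ?c * (\<Sum>i<k. (l k - l i) * l i)"
      using yang_first[OF E, of k "l k"] k le ge by simp
  qed (use mono le eigenvalue_nonneg[OF E] k assms(5) ev[of k] in auto)
  \<comment> \<open>Outside the infinite case the denominator is nonzero and nonnegative, hence
    positive, and the product inequality may be divided by it.\<close>
  ultimately show ?thesis
    unfolding sums[of "\<lambda>t. 1 - t"] sums[of "\<lambda>t. t"] sums[of "\<lambda>t. t\<^sup>2"]
    using ev[OF k] by (auto simp: pos_le_divide_eq)
qed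

end
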